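(* Let $\dot\omega=v(\omega)$, $\omega\in\mathbb{R}^p$, be the reduced Euler--Poincaré--Suslov system, and let $\omega_0\neq 0$ be a steady motion, i.e. $v(\omega_0)=0$. Then for every $\mu>0$ $$u(\mu\omega_0)=u(\omega_0),\qquad s(\mu\omega_0)=s(\omega_0),$$ and for every $\mu<0$ $$u(\mu\omega_0)=s(\omega_0),\qquad s(\mu\omega_0)=u(\omega_0).$$
   Context: Setting (Euler--Poincaré--Suslov, EPS, systems). Let $G$ be an $n$-dimensional real Lie group with Lie algebra $g$, and let $w_1,\dots,w_n$ be a basis of left-invariant vector fields with $[w_i,w_j]=\sum_{k=1}^n c_{ij}^k w_k$, $c_{ij}^k=-c_{ji}^k$ (structure constants). Let $\omega_1,\dots,\omega_n$ be the corresponding linear coordinates on $g$ (quasi-velocities). The left-invariant kinetic energy is $T=\frac12\sum_{i,j} I_{ij}\omega_i\omega_j$, where $\|I_{ij}\|$ is a constant symmetric positive definite matrix, and $m_i=\partial T/\partial\omega_i=\sum_j I_{ij}\omega_j$. There are $m<n$ linearly independent left-invariant constraints $f_1(\omega)=\dots=f_m(\omega)=0$, linear in $\omega$ with constant coefficients. The equations of motion are $$\dot m_i=\sum_{j,k=1}^n c_{ji}^k m_k\omega_j+\sum_{q=1}^m\lambda_q\frac{\partial f_q}{\partial\omega_i},\quad 1\le i\le n,\qquad f_1(\omega)=\dots=f_m(\omega)=0,$$ with Lagrange multipliers $\lambda_q$. Put $p=n-m$ and assume $p\ge 2$. The basis is chosen so that $f_1=\omega_{p+1},\dots,f_m=\omega_n$.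 Setting $\omega_{p+1}=\dots=\omega_n=0$, the first $p$ equations $$\sum_{j=1}^p I_{ij}\dot\omega_j=\sum_{j=1}^p\sum_{k=1}^n c_{ji}^k\Big(\sum_{l=1}^p I_{kl}\omega_l\Big)\omega_j,\quad 1\le i\le p,$$ form a closed system, the reduced EPS system, written $\dot\omega=v(\omega)$, $\omega=(\omega_1,\dots,\omega_p)^\top\in\mathbb{R}^p$. The components $v_1,\dots,v_p$ are homogeneous polynomials of degree 2 (so $v(\lambda\omega)=\lambda^2v(\omega)$), and the system has the first integral $H$, the restriction of $T$ to the constraint subspace, which is a positive definite quadratic form. A steady motion is a point $\omega_0\in\mathbb{R}^p$ with $v(\omega_0)=0$; then $\mu\omega_0$ is a steady motion for every $\mu\in\mathbb{R}$. For a steady motion $\omega_*$, $u(\omega_* )$ (respectively $s(\omega_* )$) denotes the number of eigenvalues, counted with algebraic multiplicity, of the linearization operator $\frac{\partial v}{\partial\omega}\big|_{\omega_*}$ lying in the open right (respectively open left) complex half-plane. *)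

theory Defs
  imports
    "HOL-Analysis.Analysis"
    "HOL-Computational_Algebra.Polynomial"
begin

(* The Lie algebra enters through a basis (w_a) indexed by 'p + 'm, with
   [w_a, w_b] = (\<Sum>e. c a b e * w_e).  The indices Inl i are the p free directions; the
   constraints are \<omega>_(Inr q) = 0, one for each q. *)

type_synonym 'n structure_constants = "'n \<Rightarrow> 'n \<Rightarrow> 'n \<Rightarrow> real"

(* Antisymmetry and the Jacobi identity: by Lie's third theorem, exactly the structure
   constants of the Lie algebras of real Lie groups. *)
definition lie_structure_constants :: "'n::finite structure_constants \<Rightarrow> bool" where
  "lie_structure_constants c \<longleftrightarrow>
     (\<forall>i j k. c i j k = - c j i k) \<and>
     (\<forall>i j k s. (\<Sum>l\<in>UNIV. c i j l * c l k s + c j k l * c l i s + c k i l * c l j s) = 0)"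

definition symmetric_positive_definite :: "real^'n^'n \<Rightarrow> bool" where
  "symmetric_positive_definite A \<longleftrightarrow> transpose A = A \<and> (\<forall>x. x \<noteq> 0 \<longrightarrow> 0 < x \<bullet> (A *v x))"

definition constrained :: "real^'p \<Rightarrow> real^('p::finite + 'm::finite)" where
  "constrained \<omega> = (\<chi> a. case a of Inl i \<Rightarrow> \<omega> $ i | Inr q \<Rightarrow> 0)"

definition reduced_inertia :: "real^('p::finite + 'm::finite)^('p + 'm) \<Rightarrow> real^'p^'p" where
  "reduced_inertia I = (\<chi> i j. I $ Inl i $ Inl j)"

(* The vector m of the components m_a = \<partial>T/\<partial>\<omega>_a of T(\<omega>) = (\<omega> \<bullet> (I *v \<omega>)) / 2
   (with I symmetric) is I *v \<omega>. *)
definition eps_force ::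
  "('p::finite + 'm::finite) structure_constants \<Rightarrow> real^('p + 'm)^('p + 'm) \<Rightarrow> real^'p \<Rightarrow> real^'p" where
  "eps_force c I \<omega> =
     (\<chi> i. \<Sum>j\<in>UNIV. \<Sum>k\<in>UNIV. c (Inl j) (Inl i) k * (I *v constrained \<omega>) $ k * \<omega> $ j)"

definition eps_field ::
  "('p::finite + 'm::finite) structure_constants \<Rightarrow> real^('p + 'm)^('p + 'm) \<Rightarrow> real^'p \<Rightarrow> real^'p" where
  "eps_field c I \<omega> = matrix_inv (reduced_inertia I) *v eps_force c I \<omega>"

lemma constrained_momentum:
  fixes I :: "real^('p::finite + 'm::finite)^('p + 'm)"
  shows "(I *v constrained \<omega>) $ k = (\<Sum>l\<in>UNIV. I $ k $ Inl l * \<omega> $ l)"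
  unfolding matrix_vector_mult_def constrained_def
  by (simp add: UNIV_Plus_UNIV[symmetric] sum.Plus del: UNIV_Plus_UNIV)

lemma inner_reduced_inertia:
  fixes I :: "real^('p::finite + 'm::finite)^('p + 'm)"
  shows "x \<bullet> (reduced_inertia I *v x) = constrained x \<bullet> (I *v constrained x)"
  unfolding inner_vec_def constrained_momentum
  by (simp add: UNIV_Plus_UNIV[symmetric] sum.Plus constrained_def reduced_inertia_def
      matrix_vector_mult_def del: UNIV_Plus_UNIV)

lemma invertible_reduced_inertia:
  fixes I :: "real^('p::finite + 'm::finite)^('p + 'm)"
  assumes "symmetric_positive_definite I"
  shows "invertible (reduced_inertia I)"
proof -
  have "x = 0" if "reduced_inertia I *v x = 0" for x :: "real^'p"
  proof (rule ccontr)
    assume "x \<noteq> 0"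
    then obtain i where "x $ i \<noteq> 0" by (auto simp: vec_eq_iff)
    then have "(constrained x :: real^('p + 'm)) $ Inl i \<noteq> 0" by (simp add: constrained_def)
    then have "(constrained x :: real^('p + 'm)) \<noteq> 0" by (metis zero_index)
    then have "0 < x \<bullet> (reduced_inertia I *v x)"
      using assms by (simp add: symmetric_positive_definite_def inner_reduced_inertia)
    with that show False by simp
  qed
  then show ?thesis
    by (auto simp: invertible_left_inverse matrix_left_invertible_ker)
qed

(* The reduced system in implicit form; it determines the field uniquely. *)
lemma eps_field_iff:
  fixes I :: "real^('p::finite + 'm::finite)^('p + 'm)"
  assumes "symmetric_positive_definite I"
  shows "a = eps_field c I \<omega> \<longleftrightarrow>
    (\<forall>i. (\<Sum>j\<in>UNIV. I $ Inl i $ Inl j * a $ j) =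
         (\<Sum>j\<in>UNIV. \<Sum>k\<in>UNIV. c (Inl j) (Inl i) k * (\<Sum>l\<in>UNIV. I $ k $ Inl l * \<omega> $ l) * \<omega> $ j))"
proof -
  let ?A = "reduced_inertia I"
  have inv: "?A ** matrix_inv ?A = mat 1" "matrix_inv ?A ** ?A = mat 1"
    using someI_ex[OF invertible_reduced_inertia[OF assms, unfolded invertible_def]]
    by (auto simp: matrix_inv_def)
  have "a = eps_field c I \<omega> \<longleftrightarrow> ?A *v a = eps_force c I \<omega>"
    unfolding eps_field_def
    by (metis inv matrix_vector_mul_assoc matrix_vector_mul_lid)
  also have "\<dots> \<longleftrightarrow> (\<forall>i. (?A *v a) $ i = eps_force c I \<omega> $ i)"
    by (simp add: vec_eq_iff)
  finally have "a = eps_field c I \<omega> \<longleftrightarrow> (\<forall>i. (?A *v a) $ i = eps_force c I \<omega> $ i)" .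
  moreover have "(?A *v a) $ i = (\<Sum>j\<in>UNIV. I $ Inl i $ Inl j * a $ j)" for i
    by (simp add: matrix_vector_mult_def reduced_inertia_def)
  ultimately show ?thesis
    by (simp add: eps_force_def constrained_momentum)
qed

definition steady_motion :: "(real^'p \<Rightarrow> real^'p) \<Rightarrow> real^'p \<Rightarrow> bool" where
  "steady_motion v \<omega> \<longleftrightarrow> v \<omega> = 0"

definition charpoly :: "'a::comm_ring_1^'n^'n \<Rightarrow> 'a poly" where
  "charpoly A = det (\<chi> i j. (if i = j then [:0, 1:] else 0) - [:A $ i $ j:])"

definition complex_eigenvalues :: "real^'n^'n \<Rightarrow> complex multiset" where
  "complex_eigenvalues A = proots (charpoly (\<chi> i j. complex_of_real (A $ i $ j)))"

definition unstable_count :: "(real^'p \<Rightarrow> real^'p) \<Rightarrow> real^'p \<Rightarrow> nat" where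
  "unstable_count v \<omega> = size {# z \<in># complex_eigenvalues (jacobian v (at \<omega>)). Re z > 0 #}"

definition stable_count :: "(real^'p \<Rightarrow> real^'p) \<Rightarrow> real^'p \<Rightarrow> nat" where
  "stable_count v \<omega> = size {# z \<in># complex_eigenvalues (jacobian v (at \<omega>)). Re z < 0 #}"

end

theory Submission
  imports Defs
begin

text \<open>The field v is homogeneous of degree 2, so its derivative is homogeneous of degree 1:
  the Jacobian at \<mu>\<omega> is \<mu> times the Jacobian at \<omega>
  (\<open>jacobian_scale_homogeneous2\<close>). Scaling a matrix by \<mu> \<noteq> 0 multiplies each
  eigenvalue by \<mu> and keeps its algebraic multiplicity
  (\<open>complex_eigenvalues_scale\<close>). Multiplication by a positive real preserves the open
  right and left half-planes, and multiplication by a negative real swaps them. Multiplicities are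
  tracked through the characteristic polynomial, by the substitution of aX for X.\<close>

text \<open>Write p = (X - ay)^n q with q(ay) \<noteq> 0. Substituting aX turns the linear factor
  into a(X - y) and q into a polynomial that does not vanish at y, so the order at y is again
  n.\<close>

lemma order_pcompose_scale:
  fixes p :: "'a::field poly"
  assumes "a \<noteq> 0" "p \<noteq> 0"
  shows "order y (pcompose p [:0, a:]) = order (a * y) p"
proof -
  let ?x = "a * y"
  let ?n = "order ?x p"
  obtain q where q: "p = [:- ?x, 1:] ^ ?n * q" "\<not> [:- ?x, 1:] dvd q"
    using order_decomp[OF assms(2)] by blast
  have lin: "pcompose [:- ?x, 1:] [:0, a:] = smult a [:- y, 1:]"
    by (simp add: pcompose_pCons)
  have pow: "pcompose (r ^ k) [:0, a:] = pcompose r [:0, a:] ^ k" for r :: "'a poly" and k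
    by (induction k) (simp_all add: pcompose_1 pcompose_mult)
  have eq: "pcompose p [:0, a:] = smult (a ^ ?n) ([:- y, 1:] ^ ?n * pcompose q [:0, a:])"
    by (subst q(1)) (simp only: pcompose_mult pow lin smult_power mult_smult_left)
  have root: "poly (pcompose q [:0, a:]) y \<noteq> 0"
    using q(2) by (simp add: poly_pcompose poly_eq_0_iff_dvd mult.commute)
  then have "pcompose q [:0, a:] \<noteq> 0"
    by auto
  then have "order y ([:- y, 1:] ^ ?n * pcompose q [:0, a:]) = ?n + order y (pcompose q [:0, a:])"
    by (subst order_mult) (simp_all add: order_power_n_n)
  with root show ?thesis
    unfolding eq using assms by (simp add: order_smult order_0I)
qed

lemma proots_pcompose_scale:
  fixes p :: "'a::field poly"
  assumes "a \<noteq> 0"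
  shows "proots p = image_mset ((*) a) (proots (pcompose p [:0, a:]))"
proof (cases "p = 0")
  case False
  \<comment> \<open>Multiplication by a is injective, so distinct roots never merge in the
    image.\<close>
  have count: "count (image_mset ((*) a) M) (a * y) = count M y" for M y
    by (induction M) (auto simp: assms)
  have nz: "pcompose p [:0, a:] \<noteq> 0"
    using False assms by (subst pcompose_eq_0_iff) auto
  show ?thesis
  proof (rule multiset_eqI)
    fix x
    \<comment> \<open>Writing x as a(x/a) exhibits the only possible preimage of x.\<close>
    have "count (image_mset ((*) a) (proots (pcompose p [:0, a:]))) (a * (x / a))
        = order (a * (x / a)) p"
      unfolding count using nz False assms by (simp add: order_pcompose_scale)
    then show "count (proots p) x = count (image_mset ((*) a) (proots (pcompose p [:0, a:]))) x"
      using assms False by simp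
  qed
qed simp

text \<open>This is det(aX - aA) = a^n det(X - A): in the expansion over permutations every product
  has n entries, each contributing one factor a.\<close>

lemma charpoly_scale:
  fixes A :: "'a::idom^'n^'n"
  shows "pcompose (charpoly (\<chi> i j. a * A $ i $ j)) [:0, a:] = smult (a ^ CARD('n)) (charpoly A)"
proof -
  have entry: "pcompose ((if i = j then [:0, 1:] else 0) - [:a * A $ i $ j:]) [:0, a:]
      = [:a:] * ((if i = j then [:0, 1:] else 0) - [:A $ i $ j:])" for i j :: 'n
    by (simp add: pcompose_diff pcompose_pCons)
  have pow: "[:a:] ^ k = [:a ^ k:]" for k
    by (induction k) (simp_all add: one_pCons)
  \<comment> \<open>The signs of the permutations are constants, fixed by the substitution.\<close>
  have int: "pcompose (of_int k) r = of_int k" for k and r :: "'a poly"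
    by (simp add: of_int_poly)
  have smult: "smult b p = [:b:] * p" for b and p :: "'a poly"
    by simp
  show ?thesis
    unfolding charpoly_def det_def smult
    by (simp add: pcompose_sum pcompose_mult pcompose_prod entry prod.distrib pow int
        sum_distrib_left ac_simps
        del: mult_pCons_left)
qed

lemma complex_eigenvalues_scale:
  fixes A :: "real^'n^'n"
  assumes "\<mu> \<noteq> 0"
  shows "complex_eigenvalues (\<mu> *\<^sub>R A)
       = image_mset ((*) (complex_of_real \<mu>)) (complex_eigenvalues A)"
proof -
  let ?a = "complex_of_real \<mu>"
  let ?A = "\<chi> i j. complex_of_real (A $ i $ j)"
  have "complex_eigenvalues (\<mu> *\<^sub>R A) = proots (charpoly (\<chi> i j. ?a * ?A $ i $ j))"
    by (simp add: complex_eigenvalues_def)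
  also have "\<dots> = image_mset ((*) ?a) (proots (smult (?a ^ CARD('n)) (charpoly ?A)))"
    using assms proots_pcompose_scale[of ?a "charpoly (\<chi> i j. ?a * ?A $ i $ j)"]
    unfolding charpoly_scale by simp
  \<comment> \<open>The nonzero constant factor leaves the roots and their multiplicities
    unchanged.\<close>
  finally show ?thesis
    using assms by (simp add: complex_eigenvalues_def)
qed

text \<open>Differentiate v(x) = \<mu>^2 v(x/\<mu>) at x = \<mu>\<omega>: the chain rule gives the
  factor \<mu>^2 / \<mu> = \<mu>. In this form, differentiability at \<omega> alone yields it at
  \<mu>\<omega>.\<close>

lemma jacobian_scale_homogeneous2:
  fixes v :: "real^'p \<Rightarrow> real^'p"
  assumes hom: "\<And>a x. v (a *\<^sub>R x) = a\<^sup>2 *\<^sub>R v x"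
    and diff: "v differentiable at \<omega>"
    and "\<mu> \<noteq> 0"
  shows "jacobian v (at (\<mu> *\<^sub>R \<omega>)) = \<mu> *\<^sub>R jacobian v (at \<omega>)"
proof -
  let ?J = "jacobian v (at \<omega>)"
  have "((\<lambda>x. inverse \<mu> *\<^sub>R x) has_derivative (\<lambda>h. inverse \<mu> *\<^sub>R h)) (at (\<mu> *\<^sub>R \<omega>))"
    by (auto intro!: derivative_eq_intros)
  moreover have "(v has_derivative ((*v) ?J)) (at (inverse \<mu> *\<^sub>R \<mu> *\<^sub>R \<omega>))"
    using diff \<open>\<mu> \<noteq> 0\<close> by (simp add: jacobian_works)
  ultimately have "((\<lambda>x. v (inverse \<mu> *\<^sub>R x)) has_derivative (\<lambda>h. ?J *v (inverse \<mu> *\<^sub>R h)))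
      (at (\<mu> *\<^sub>R \<omega>))"
    by (rule has_derivative_compose)
  then have "((\<lambda>x. \<mu>\<^sup>2 *\<^sub>R v (inverse \<mu> *\<^sub>R x)) has_derivative
      (\<lambda>h. \<mu>\<^sup>2 *\<^sub>R (?J *v (inverse \<mu> *\<^sub>R h)))) (at (\<mu> *\<^sub>R \<omega>))"
    by (rule has_derivative_scaleR_right)
  moreover have "\<mu>\<^sup>2 *\<^sub>R v (inverse \<mu> *\<^sub>R x) = v x" for x
    using \<open>\<mu> \<noteq> 0\<close> by (simp flip: hom)
  moreover have "\<mu>\<^sup>2 *\<^sub>R (?J *v (inverse \<mu> *\<^sub>R h)) = (\<mu> *\<^sub>R ?J) *v h" for h
    using \<open>\<mu> \<noteq> 0\<close>
    by (simp add: matrix_vector_mult_scaleR scaleR_matrix_vector_assoc[symmetric] power2_eq_square)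
  ultimately have "(v has_derivative ((*v) (\<mu> *\<^sub>R ?J))) (at (\<mu> *\<^sub>R \<omega>))"
    by simp
  then have "frechet_derivative v (at (\<mu> *\<^sub>R \<omega>)) = (*v) (\<mu> *\<^sub>R ?J)"
    using frechet_derivative_at by metis
  then show ?thesis
    by (simp add: jacobian_def)
qed

text \<open>Each component of the force is a quadratic form, a sum of products of a momentum linear
  in \<omega> with a velocity, and the inverse inertia matrix acts linearly.\<close>

lemma eps_field_scaleR:
  "eps_field c I (a *\<^sub>R \<omega>) = a\<^sup>2 *\<^sub>R eps_field c I \<omega>"
proof -
  have "eps_force c I (a *\<^sub>R \<omega>) = a\<^sup>2 *\<^sub>R eps_force c I \<omega>"
    by (simp add: eps_force_def constrained_momentum vec_eq_iff sum_distrib_left sum_distrib_right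
        power2_eq_square algebra_simps)
  then show ?thesis
    by (simp add: eps_field_def matrix_vector_mult_scaleR)
qed

lemma eps_field_differentiable: "eps_field c I differentiable at \<omega>"
proof -
  have "(\<lambda>x. x $ j) differentiable at \<omega>" for j
    by (rule bounded_linear_imp_differentiable[OF bounded_linear_vec_nth])
  then have "(\<lambda>x. eps_field c I x $ i) differentiable at \<omega>" for i
    unfolding eps_field_def matrix_vector_mult_def[of "matrix_inv _"] eps_force_def constrained_momentum
    by (simp add: differentiable_sum differentiable_mult)
  then show ?thesis
    by (subst differentiable_componentwise_within)
      (auto simp: Basis_vec_def inner_axis)
qed

theorem theorem2:
  fixes c :: "('p::finite + 'm::finite) structure_constants"
    and I :: "real^('p + 'm)^('p + 'm)"
    and \<omega>\<^sub>0 :: "real^'p"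
  assumes "CARD('p) \<ge> 2"
    and "lie_structure_constants c"
    and "symmetric_positive_definite I"
    and "steady_motion (eps_field c I) \<omega>\<^sub>0"
    and "\<omega>\<^sub>0 \<noteq> 0"
  shows "(\<forall>\<mu>>0. unstable_count (eps_field c I) (\<mu> *\<^sub>R \<omega>\<^sub>0) = unstable_count (eps_field c I) \<omega>\<^sub>0
               \<and> stable_count (eps_field c I) (\<mu> *\<^sub>R \<omega>\<^sub>0) = stable_count (eps_field c I) \<omega>\<^sub>0)
       \<and> (\<forall>\<mu><0. unstable_count (eps_field c I) (\<mu> *\<^sub>R \<omega>\<^sub>0) = stable_count (eps_field c I) \<omega>\<^sub>0
               \<and> stable_count (eps_field c I) (\<mu> *\<^sub>R \<omega>\<^sub>0) = unstable_count (eps_field c I) \<omega>\<^sub>0)"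
proof -
  let ?v = "eps_field c I"
  let ?E = "complex_eigenvalues (jacobian ?v (at \<omega>\<^sub>0))"
  have "complex_eigenvalues (jacobian ?v (at (\<mu> *\<^sub>R \<omega>\<^sub>0)))
      = image_mset ((*) (complex_of_real \<mu>)) ?E" if "\<mu> \<noteq> 0" for \<mu>
    using that
    by (simp add: jacobian_scale_homogeneous2 eps_field_scaleR eps_field_differentiable
        complex_eigenvalues_scale)
  \<comment> \<open>Since \<mu> is real, Re(\<mu>z) = \<mu> Re z, so the sign of \<mu> decides which
    half-plane of the eigenvalues at \<open>\<omega>\<^sub>0\<close> is counted.\<close>
  then show ?thesis
    by (auto simp: unstable_count_def stable_count_def filter_mset_image_mset
        zero_less_mult_iff mult_less_0_iff)
qed

end
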